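(* Let $\Psi_{\mathbf{G}}$ be the chromatic symmetric function and $\tilde\Psi$ the augmented chromatic invariant, both extended linearly to the vector space $\mathbf{G}$. Then $\ker\tilde\Psi=\ker\Psi_{\mathbf{G}}$. In particular, for graphs $G_1,G_2$ we have $\Psi_{\mathbf{G}}(G_1)=\Psi_{\mathbf{G}}(G_2)$ if and only if $\tilde\Psi(G_1)=\tilde\Psi(G_2)$.
   Context: $\mathbb{K}$ is a field of characteristic zero, $\mathbb{N}=\{1,2,\dots\}$. $\mathbf{G}=\bigoplus_{n\ge 0}\mathbf{G}_n$, where $\mathbf{G}_n$ is the $\mathbb{K}$-vector space freely generated by the (simple) graphs with vertex set $[n]$. A coloring of $G$ is a function $f:V(G)\to\mathbb{N}$, proper if no edge is monochromatic, and $x_f=\prod_{v\in V(G)}x_{f(v)}$. The chromatic symmetric function is $\Psi_{\mathbf{G}}(G)=\sum_f x_f$ over proper colorings $f$ of $G$, in the commuting variables $x_1,x_2,\dots$. Let $R$ be the ring of formal power series in the commuting variables $x_1,x_2,\dots$ with coefficients in the commutative ring $\mathbb{K}[q_1,q_2,\dots]/\big(q_i(q_i-1)^2 : i\ge1\big)$. The augmented chromatic invariant is $\tilde\Psi(G)=\sum_f x_f\prod_i q_i^{c_G(f,i)}\in R$, where the sum runs over all colorings $f$ of $G$ (not only proper ones) and $c_G(f,i)$ is the number of edges $\{v_1,v_2\}$ of $G$ with $f(v_1)=f(v_2)=i$. *)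

theory Defs
  imports Complex_Main "HOL-Library.Poly_Mapping" "HOL-Library.FuncSet"
begin

section \<open>Formal power series in countably many commuting variables\<close>

text \<open>
  The colours and the indices of the variables, 1, 2, 3, ... on paper, are represented by
  \<^typ>\<open>nat\<close> throughout: the number \<^term>\<open>i\<close> stands for the colour with number i + 1.
  A monomial in the variables is its exponent vector, of type \<^typ>\<open>nat \<Rightarrow>\<^sub>0 nat\<close>.
\<close>

type_synonym monomial = "nat \<Rightarrow>\<^sub>0 nat"

lemma finite_add_decomp: "finite {p :: monomial \<times> monomial. fst p + snd p = m}"
proof -
  let ?K = "Poly_Mapping.keys m" and ?B = "\<Sum>i\<in>Poly_Mapping.keys m. Poly_Mapping.lookup m i"
  let ?F = "{f :: nat \<Rightarrow> nat. \<forall>x. (x \<in> ?K \<longrightarrow> f x \<in> {..?B}) \<and> (x \<notin> ?K \<longrightarrow> f x = 0)}"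
  let ?L = "{a :: monomial. Poly_Mapping.lookup a \<in> ?F}"
  have "finite ?F" by (rule finite_set_of_finite_funs) auto
  then have "finite (Poly_Mapping.lookup -` ?F)"
    by (rule finite_vimageI) (auto intro!: injI poly_mapping_eqI)
  then have L: "finite ?L" by (simp add: vimage_def)
  have le: "a \<in> ?L"
    if a: "\<And>x. Poly_Mapping.lookup a x \<le> Poly_Mapping.lookup m x" for a :: monomial
  proof -
    have "Poly_Mapping.lookup a x \<le> ?B" if "x \<in> ?K" for x
      using that by (intro order_trans[OF a] member_le_sum) auto
    moreover have "Poly_Mapping.lookup a x = 0" if "x \<notin> ?K" for x
      using a[of x] that by (simp add: in_keys_iff)
    ultimately show ?thesis by auto
  qed
  have "{p. fst p + snd p = m} \<subseteq> ?L \<times> ?L"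
  proof
    fix p :: "monomial \<times> monomial" assume "p \<in> {p. fst p + snd p = m}"
    then have m: "m = fst p + snd p" by simp
    have "fst p \<in> ?L" by (rule le) (simp add: m lookup_add)
    moreover have "snd p \<in> ?L" by (rule le) (simp add: m lookup_add)
    ultimately have "(fst p, snd p) \<in> ?L \<times> ?L" by (rule SigmaI)
    then show "p \<in> ?L \<times> ?L" by (simp only: prod.collapse)
  qed
  then show ?thesis by (rule finite_subset) (intro finite_cartesian_product L)
qed

typedef 'a mps = "UNIV :: (monomial \<Rightarrow> 'a) set"
  morphisms mps_coeff Abs_mps ..

lemma mps_coeff_Abs [simp]: "mps_coeff (Abs_mps f) = f"
  by (simp add: Abs_mps_inverse)

lemma mps_eqI: "(\<And>m. mps_coeff a m = mps_coeff b m) \<Longrightarrow> a = b"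
  by (metis ext mps_coeff_inject)

instantiation mps :: (comm_ring_1) comm_ring_1
begin

definition "0 = Abs_mps (\<lambda>m. 0)"
definition "1 = Abs_mps (\<lambda>m. if m = 0 then 1 else 0)"
definition "a + b = Abs_mps (\<lambda>m. mps_coeff a m + mps_coeff b m)"
definition "- a = Abs_mps (\<lambda>m. - mps_coeff a m)"
definition "a - b = Abs_mps (\<lambda>m. mps_coeff a m - mps_coeff b m)"
definition "a * b =
  Abs_mps (\<lambda>m. \<Sum>p | fst p + snd p = m. mps_coeff a (fst p) * mps_coeff b (snd p))"

instance
proof
  fix a b c :: "'a mps"
  show "a + b + c = a + (b + c)" "a + b = b + a" "0 + a = a" "- a + a = 0" "a - b = a + - b"
    by (auto intro!: mps_eqI
        simp: plus_mps_def zero_mps_def uminus_mps_def minus_mps_def algebra_simps)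
  show "(0 :: 'a mps) \<noteq> 1"
  proof
    assume "(0 :: 'a mps) = 1"
    then have "mps_coeff (0 :: 'a mps) 0 = mps_coeff 1 0" by simp
    then show False by (simp add: zero_mps_def one_mps_def)
  qed
  show "a * b = b * a"
  proof (rule mps_eqI)
    fix m :: monomial
    have "(\<Sum>p | fst p + snd p = m. mps_coeff a (fst p) * mps_coeff b (snd p)) =
          (\<Sum>p | fst p + snd p = m. mps_coeff b (fst p) * mps_coeff a (snd p))"
      by (rule sum.reindex_bij_witness[of _ prod.swap prod.swap])
        (auto simp: ac_simps)
    then show "mps_coeff (a * b) m = mps_coeff (b * a) m" by (simp add: times_mps_def)
  qed
  show "1 * a = a"
  proof (rule mps_eqI)
    fix m :: monomial
    have "(\<Sum>p | fst p + snd p = m. (if fst p = 0 then 1 else 0) * mps_coeff a (snd p)) =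
          (\<Sum>p\<in>{(0 :: monomial, m)}. (if fst p = 0 then 1 else 0) * mps_coeff a (snd p))"
      by (intro sum.mono_neutral_right finite_add_decomp) auto
    then show "mps_coeff (1 * a) m = mps_coeff a m" by (simp add: times_mps_def one_mps_def)
  qed
  show "(a + b) * c = a * c + b * c"
    by (rule mps_eqI) (simp add: times_mps_def plus_mps_def distrib_right sum.distrib)
  show "a * b * c = a * (b * c)"
  proof (rule mps_eqI)
    fix m :: monomial
    have "mps_coeff (a * b * c) m =
       (\<Sum>p | fst p + snd p = m. \<Sum>r | fst r + snd r = fst p.
          mps_coeff a (fst r) * mps_coeff b (snd r) * mps_coeff c (snd p))"
      by (simp add: times_mps_def sum_distrib_right)
    also have "\<dots> = (\<Sum>(p, r) \<in> (SIGMA p:{p. fst p + snd p = m}. {r. fst r + snd r = fst p}).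
          mps_coeff a (fst r) * mps_coeff b (snd r) * mps_coeff c (snd p))"
      by (rule sum.Sigma) (auto intro: finite_add_decomp)
    also have "\<dots> = (\<Sum>(p, r) \<in> (SIGMA p:{p. fst p + snd p = m}. {r. fst r + snd r = snd p}).
          mps_coeff a (fst p) * (mps_coeff b (fst r) * mps_coeff c (snd r)))"
      by (rule sum.reindex_bij_witness
          [of _ "\<lambda>(p, r). ((fst p + fst r, snd r), (fst p, fst r))"
                "\<lambda>(p, r). ((fst r, snd r + snd p), (snd r, snd p))"])
        (auto simp: ac_simps)
    also have "\<dots> = (\<Sum>p | fst p + snd p = m. \<Sum>r | fst r + snd r = snd p.
          mps_coeff a (fst p) * (mps_coeff b (fst r) * mps_coeff c (snd r)))"
      by (rule sum.Sigma[symmetric]) (auto intro: finite_add_decomp)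
    also have "\<dots> = mps_coeff (a * (b * c)) m"
      by (simp add: times_mps_def sum_distrib_left)
    finally show "mps_coeff (a * b * c) m = mps_coeff (a * (b * c)) m" .
  qed
qed

end

definition mps_const :: "'a :: comm_ring_1 \<Rightarrow> 'a mps" where
  "mps_const c = Abs_mps (\<lambda>m. if m = 0 then c else 0)"

definition mps_X :: "nat \<Rightarrow> 'a :: comm_ring_1 mps" where
  "mps_X i = Abs_mps (\<lambda>m. if m = Poly_Mapping.single i 1 then 1 else 0)"

text \<open>
  The sum of a possibly infinite family of power series, taken coefficientwise. It is only
  meaningful if each monomial occurs in finitely many members of the family; that this is so for
  the families below is shown at the end of this theory.
\<close>

definition mps_Sum :: "('b \<Rightarrow> 'a :: comm_ring_1 mps) \<Rightarrow> 'b set \<Rightarrow> 'a mps" where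
  "mps_Sum g A = Abs_mps (\<lambda>m. \<Sum>f | f \<in> A \<and> mps_coeff (g f) m \<noteq> 0. mps_coeff (g f) m)"


section \<open>The coefficient ring of the augmented invariant\<close>

text \<open>
  With exponent vectors as keys, the convolution product of \<^theory>\<open>HOL-Library.Poly_Mapping\<close>
  is the product of polynomials in countably many variables.
\<close>

type_synonym 'k polys = "monomial \<Rightarrow>\<^sub>0 'k"

definition poly_q :: "nat \<Rightarrow> 'k :: comm_ring_1 polys" where
  "poly_q i = Poly_Mapping.single (Poly_Mapping.single i 1) 1"

interpretation ring_ideal: module "(*) :: 'a :: comm_ring_1 \<Rightarrow> 'a \<Rightarrow> 'a"
  by standard (simp_all add: algebra_simps)

text \<open>The linear span in a commutative ring, as a module over itself, is the generated ideal.\<close>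

definition q_ideal :: "'k :: comm_ring_1 polys set" where
  "q_ideal = ring_ideal.span (range (\<lambda>i. poly_q i * (poly_q i - 1)\<^sup>2))"

lemma diff_diff_add_swap: "(a - b) - (c - d) = (a - c) - (b - d)" for a :: "'a :: ab_group_add"
  by (simp add: algebra_simps)

lemma ideal_mult_cong:
  assumes "a - b \<in> ring_ideal.span S" "c - d \<in> ring_ideal.span S"
  shows "a * c - b * d \<in> ring_ideal.span S"
proof -
  have "a * c - b * d = c * (a - b) + b * (c - d)" by (simp add: algebra_simps)
  then show ?thesis using assms by (simp add: ring_ideal.span_add ring_ideal.span_scale)
qed

lemma q_ideal_eqI: "p = p' \<Longrightarrow> p - p' \<in> q_ideal"
  by (simp add: q_ideal_def ring_ideal.span_zero)

quotient_type (overloaded) 'k qring = "'k :: comm_ring_1 polys" / "\<lambda>p p'. p - p' \<in> q_ideal"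
proof (rule equivpI)
  show "reflp (\<lambda>p p' :: 'k polys. p - p' \<in> q_ideal)"
    by (intro reflpI q_ideal_eqI refl)
  show "symp (\<lambda>p p' :: 'k polys. p - p' \<in> q_ideal)"
  proof (rule sympI)
    fix p p' :: "'k polys" assume "p - p' \<in> q_ideal"
    then have "- (p - p') \<in> q_ideal" unfolding q_ideal_def by (rule ring_ideal.span_neg)
    then show "p' - p \<in> q_ideal" by simp
  qed
  show "transp (\<lambda>p p' :: 'k polys. p - p' \<in> q_ideal)"
  proof (rule transpI)
    fix p p' r :: "'k polys" assume "p - p' \<in> q_ideal" "p' - r \<in> q_ideal"
    then have "(p - p') + (p' - r) \<in> q_ideal" unfolding q_ideal_def by (rule ring_ideal.span_add)
    then show "p - r \<in> q_ideal" by simp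
  qed
qed

lemma monomial_add_eq_0: "0 = a + b \<longleftrightarrow> a = 0 \<and> b = (0 :: monomial)"
  by (auto simp: poly_mapping_eq_iff fun_eq_iff lookup_add)

lemma lookup_mult_0:
  fixes p p' :: "'k :: comm_ring_1 polys"
  shows "Poly_Mapping.lookup (p * p') 0 = Poly_Mapping.lookup p 0 * Poly_Mapping.lookup p' 0"
proof -
  have inner: "(\<lambda>l. Poly_Mapping.lookup p l * (\<Sum>r. (Poly_Mapping.lookup p' r when 0 = l + r))) =
        (\<lambda>l. (Poly_Mapping.lookup p l * Poly_Mapping.lookup p' 0 when l = 0))"
    by (auto simp: fun_eq_iff monomial_add_eq_0 when_def)
  show ?thesis unfolding lookup_mult prod_fun_def inner by simp
qed

text \<open>The constant coefficient vanishes on the ideal; hence the ideal is proper.\<close>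

lemma q_ideal_lookup_0: "p \<in> q_ideal \<Longrightarrow> Poly_Mapping.lookup p 0 = 0"
  unfolding q_ideal_def
proof (induction rule: ring_ideal.span_induct_alt)
  case base
  then show ?case by simp
next
  case (step c x y)
  then show ?case
    by (auto simp: lookup_add lookup_mult_0 poly_q_def lookup_single when_def poly_mapping_eq_iff
        fun_eq_iff)
qed

instantiation qring :: (comm_ring_1) comm_ring_1
begin

lift_definition zero_qring :: "'a qring" is 0 .
lift_definition one_qring :: "'a qring" is 1 .
lift_definition plus_qring :: "'a qring \<Rightarrow> 'a qring \<Rightarrow> 'a qring" is "(+)"
  unfolding q_ideal_def add_diff_add by (rule ring_ideal.span_add)
lift_definition uminus_qring :: "'a qring \<Rightarrow> 'a qring" is uminus
  unfolding q_ideal_def minus_diff_minus by (rule ring_ideal.span_neg)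
lift_definition minus_qring :: "'a qring \<Rightarrow> 'a qring \<Rightarrow> 'a qring" is "(-)"
  unfolding q_ideal_def diff_diff_add_swap by (rule ring_ideal.span_diff)
lift_definition times_qring :: "'a qring \<Rightarrow> 'a qring \<Rightarrow> 'a qring" is "(*)"
  unfolding q_ideal_def by (rule ideal_mult_cong)

instance
proof
  fix a b c :: "'a qring"
  show "(0 :: 'a qring) \<noteq> 1"
    by transfer (use q_ideal_lookup_0[of "0 - 1 :: 'a polys"] in \<open>auto simp: lookup_minus\<close>)
  show "a + b + c = a + (b + c)"
    by transfer (rule q_ideal_eqI, rule add.assoc)
  show "a + b = b + a"
    by transfer (rule q_ideal_eqI, rule add.commute)
  show "0 + a = a"
    by transfer (rule q_ideal_eqI, rule add_0)
  show "- a + a = 0"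
    by transfer (rule q_ideal_eqI, rule left_minus)
  show "a - b = a + - b"
    by transfer (rule q_ideal_eqI, rule diff_conv_add_uminus)
  show "a * b * c = a * (b * c)"
    by transfer (rule q_ideal_eqI, rule mult.assoc)
  show "a * b = b * a"
    by transfer (rule q_ideal_eqI, rule mult.commute)
  show "1 * a = a"
    by transfer (rule q_ideal_eqI, rule mult_1)
  show "(a + b) * c = a * c + b * c"
    by transfer (rule q_ideal_eqI, rule distrib_right)
qed

end

lift_definition qvar :: "nat \<Rightarrow> 'k :: comm_ring_1 qring" is poly_q .

lift_definition qring_const :: "'k :: comm_ring_1 \<Rightarrow> 'k qring"
  is "\<lambda>c. Poly_Mapping.single 0 c" .


section \<open>Graphs and colourings\<close>

text \<open>A simple graph with vertex set {1..n} is a pair of n and its set of two-element edges.\<close>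

typedef sgraph = "{(n :: nat, E :: nat set set). \<forall>e\<in>E. e \<subseteq> {1..n} \<and> card e = 2}"
  by (rule exI[of _ "(0, {})"]) simp

definition verts :: "sgraph \<Rightarrow> nat set" where
  "verts G = {1..fst (Rep_sgraph G)}"

definition edges :: "sgraph \<Rightarrow> nat set set" where
  "edges G = snd (Rep_sgraph G)"

definition colorings :: "sgraph \<Rightarrow> (nat \<Rightarrow> nat) set" where
  "colorings G = verts G \<rightarrow>\<^sub>E UNIV"

definition proper :: "sgraph \<Rightarrow> (nat \<Rightarrow> nat) \<Rightarrow> bool" where
  "proper G f \<longleftrightarrow> (\<forall>u v. {u, v} \<in> edges G \<longrightarrow> f u \<noteq> f v)"

definition mono_edges :: "sgraph \<Rightarrow> (nat \<Rightarrow> nat) \<Rightarrow> nat \<Rightarrow> nat" where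
  "mono_edges G f i = card {e \<in> edges G. \<forall>v\<in>e. f v = i}"

definition x_coloring :: "sgraph \<Rightarrow> (nat \<Rightarrow> nat) \<Rightarrow> 'a :: comm_ring_1 mps" where
  "x_coloring G f = (\<Prod>v\<in>verts G. mps_X (f v))"


section \<open>The two invariants and their linear extensions\<close>

definition chrom :: "sgraph \<Rightarrow> 'k :: comm_ring_1 mps" where
  "chrom G = mps_Sum (x_coloring G) {f \<in> colorings G. proper G f}"

text \<open>In the product over all colours below, only finitely many factors differ from 1.\<close>

definition aug_chrom :: "sgraph \<Rightarrow> 'k :: comm_ring_1 qring mps" where
  "aug_chrom G =
     mps_Sum (\<lambda>f. x_coloring G f * mps_const (\<Prod>i. qvar i ^ mono_edges G f i)) (colorings G)"

text \<open>
  The direct sum over n of the spaces freely generated by the graphs on {1..n} is the space freely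
  generated by all graphs, that is, the space of finitely supported functions on graphs.
\<close>

type_synonym 'k graph_space = "sgraph \<Rightarrow>\<^sub>0 'k"

definition chrom_lin :: "'k :: comm_ring_1 graph_space \<Rightarrow> 'k mps" where
  "chrom_lin v = (\<Sum>G\<in>Poly_Mapping.keys v. mps_const (Poly_Mapping.lookup v G) * chrom G)"

definition aug_chrom_lin :: "'k :: comm_ring_1 graph_space \<Rightarrow> 'k qring mps" where
  "aug_chrom_lin v =
     (\<Sum>G\<in>Poly_Mapping.keys v. mps_const (qring_const (Poly_Mapping.lookup v G)) * aug_chrom G)"


section \<open>Well-definedness of the infinite sums and products, values on single graphs\<close>

lemma mps_coeff_const_mult: "mps_coeff (mps_const c * a) m = c * mps_coeff a m"
proof -
  have "(\<Sum>p | fst p + snd p = m. (if fst p = 0 then c else 0) * mps_coeff a (snd p)) =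
        (\<Sum>p\<in>{(0 :: monomial, m)}. (if fst p = 0 then c else 0) * mps_coeff a (snd p))"
    by (intro sum.mono_neutral_right finite_add_decomp) auto
  then show ?thesis by (simp add: times_mps_def mps_const_def)
qed

lemma mps_coeff_X_mult_eq_0:
  fixes a :: "'a :: comm_ring_1 mps"
  assumes "\<And>m'. m = Poly_Mapping.single i 1 + m' \<Longrightarrow> mps_coeff a m' = 0"
  shows "mps_coeff (mps_X i * a) m = 0"
proof -
  have "mps_coeff (mps_X i :: 'a mps) (fst p) * mps_coeff a (snd p) = 0"
    if "p \<in> {p. fst p + snd p = m}" for p
  proof (cases "fst p = Poly_Mapping.single i 1")
    case True
    with that have "m = Poly_Mapping.single i 1 + snd p" by auto
    from assms[OF this] show ?thesis by simp
  next
    case False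
    then show ?thesis by (simp add: mps_X_def)
  qed
  then show ?thesis unfolding times_mps_def mps_coeff_Abs by (intro sum.neutral ballI)
qed

lemma mps_coeff_x_coloring_eq_0:
  assumes "m \<noteq> (\<Sum>v\<in>verts G. Poly_Mapping.single (f v) 1)"
  shows "mps_coeff (x_coloring G f :: 'a :: comm_ring_1 mps) m = 0"
proof -
  have "mps_coeff (\<Prod>v\<in>A. mps_X (f v) :: 'a mps) m = 0"
    if "finite A" "m \<noteq> (\<Sum>v\<in>A. Poly_Mapping.single (f v) 1)" for A m
    using that
  proof (induction A arbitrary: m rule: finite_induct)
    case empty
    then show ?case by (simp add: one_mps_def)
  next
    case (insert v A)
    have "mps_coeff (\<Prod>w\<in>A. mps_X (f w) :: 'a mps) m' = 0"
      if "m = Poly_Mapping.single (f v) 1 + m'" for m'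
      using insert that by (intro insert.IH) auto
    then show ?case
      unfolding prod.insert[OF insert.hyps] by (rule mps_coeff_X_mult_eq_0)
  qed
  then show ?thesis using assms by (simp add: x_coloring_def verts_def)
qed

lemma finite_colorings_of_monomial:
  fixes c :: "(nat \<Rightarrow> nat) \<Rightarrow> 'a :: comm_ring_1"
  shows "finite {f \<in> colorings G. mps_coeff (x_coloring G f * mps_const (c f)) m \<noteq> 0}"
proof (rule finite_subset)
  show "{f \<in> colorings G. mps_coeff (x_coloring G f * mps_const (c f)) m \<noteq> 0}
        \<subseteq> verts G \<rightarrow>\<^sub>E Poly_Mapping.keys m"
  proof (clarsimp simp: colorings_def PiE_iff)
    fix f v
    assume nz: "mps_coeff (x_coloring G f * mps_const (c f)) m \<noteq> 0" and v: "v \<in> verts G"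
    have "mps_coeff (x_coloring G f * mps_const (c f)) m = c f * mps_coeff (x_coloring G f) m"
      by (metis mps_coeff_const_mult mult.commute)
    with nz have "mps_coeff (x_coloring G f :: 'a mps) m \<noteq> 0" by auto
    then have m: "m = (\<Sum>v\<in>verts G. Poly_Mapping.single (f v) 1)"
      using mps_coeff_x_coloring_eq_0 by blast
    have "1 \<le> (\<Sum>w\<in>verts G. Poly_Mapping.lookup (Poly_Mapping.single (f w) 1) (f v) :: nat)"
      using member_le_sum[OF v, of "\<lambda>w. Poly_Mapping.lookup (Poly_Mapping.single (f w) (1::nat)) (f v)"]
      by (simp add: verts_def)
    also have "\<dots> = Poly_Mapping.lookup m (f v)" by (simp add: m lookup_sum)
    finally show "f v \<in> Poly_Mapping.keys m" by (simp add: in_keys_iff)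
  qed
  show "finite (verts G \<rightarrow>\<^sub>E Poly_Mapping.keys m)" by (rule finite_PiE) (simp_all add: verts_def)
qed

lemma finite_proper_colorings_of_monomial:
  "finite {f \<in> {f \<in> colorings G. proper G f}.
     mps_coeff (x_coloring G f :: 'a :: comm_ring_1 mps) m \<noteq> 0}"
proof (rule finite_subset)
  have "mps_const 1 = (1 :: 'a mps)" by (simp add: mps_const_def one_mps_def)
  then show "finite {f \<in> colorings G. mps_coeff (x_coloring G f :: 'a mps) m \<noteq> 0}"
    using finite_colorings_of_monomial[of G "\<lambda>_. 1 :: 'a" m] by simp
qed auto

lemma edges_subset: "e \<in> edges G \<Longrightarrow> e \<subseteq> verts G \<and> card e = 2"
  using Rep_sgraph[of G] by (auto simp: edges_def verts_def split: prod.splits)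

lemma finite_mono_edges: "finite {i. (qvar i ^ mono_edges G f i :: 'k :: comm_ring_1 qring) \<noteq> 1}"
proof (rule finite_subset)
  show "{i. (qvar i ^ mono_edges G f i :: 'k qring) \<noteq> 1} \<subseteq> f ` verts G"
  proof (rule subsetI, rule ccontr)
    fix i assume i: "i \<in> {i. (qvar i ^ mono_edges G f i :: 'k qring) \<noteq> 1}" "i \<notin> f ` verts G"
    have "{e \<in> edges G. \<forall>v\<in>e. f v = i} = {}"
    proof (intro equals0I, clarify)
      fix e assume e: "e \<in> edges G" "\<forall>v\<in>e. f v = i"
      from edges_subset[OF e(1)] obtain v where "v \<in> e" "v \<in> verts G"
        by (metis card.empty all_not_in_conv subsetD zero_neq_numeral)
      with e i(2) show False by auto
    qed
    then have "mono_edges G f i = 0" by (simp only: mono_edges_def card.empty)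
    with i(1) show False by simp
  qed
  show "finite (f ` verts G)" by (simp add: verts_def)
qed

lemma chrom_lin_single:
  "chrom_lin (Poly_Mapping.single G 1) = (chrom G :: 'k :: comm_ring_1 mps)"
  by (rule mps_eqI) (simp add: chrom_lin_def mps_coeff_const_mult)

lemma aug_chrom_lin_single:
  "aug_chrom_lin (Poly_Mapping.single G (1 :: 'k)) = (aug_chrom G :: 'k :: comm_ring_1 qring mps)"
proof -
  have "qring_const 1 = (1 :: 'k qring)"
    by transfer (rule q_ideal_eqI, simp)
  then show ?thesis
    by (intro mps_eqI) (simp add: aug_chrom_lin_def mps_coeff_const_mult)
qed

end

theory Submission
  imports Defs
begin

text \<open>
  Setting all q to 0 turns the augmented invariant into the chromatic symmetric function. For the
  converse, modulo \<open>q (q - 1)\<^sup>2\<close> the power \<open>q ^ c\<close> is a combination, with coefficients not depending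
  on c, of [c = 0], 1 and c. So the coefficient of a monomial in the augmented invariant is a
  combination of counts of colourings in which each colour class is required to be stable, is left
  free, or is weighted by its number of edges. Each such count is a linear function of
  the chromatic symmetric function: recolouring one vertex of a class of size k with a fresh colour,
  in all k ways, multiplies the count by k if the class is free and by k - 2 if its edges are
  counted, since every edge survives the removal of k - 2 of the vertices. Because the characteristic
  is 0, one can divide and shrink the class, until it has one vertex (free) or at most
  two (counted), where counting edges is the same as free minus stable.
\<close>

section \<open>The coefficient ring\<close>

text \<open>
  Interpreting the ring as a module over itself made a left-associating rule for the product a
  simplification rule, which loops with \<open>algebra_simps\<close>.
\<close>

declare ring_ideal.scale_scale [simp del]

section \<open>The embedding of constants and evaluation at q = 0\<close>

lemma qring_const_add: "qring_const (a + b) = qring_const a + qring_const b"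
  by transfer (rule q_ideal_eqI, rule single_add)

lemma qring_const_mult: "qring_const (a * b) = qring_const a * qring_const b"
  by transfer (rule q_ideal_eqI, simp add: mult_single)

lemma qring_const_0: "qring_const 0 = 0"
  by transfer (rule q_ideal_eqI, simp)

lemma qring_const_1: "qring_const 1 = 1"
  by transfer (rule q_ideal_eqI, simp)

lemma qring_const_of_nat: "qring_const (of_nat n) = of_nat n"
  by (induction n) (simp_all add: qring_const_0 qring_const_1 qring_const_add)

lemma qring_const_sum: "qring_const (sum g A) = (\<Sum>x\<in>A. qring_const (g x))"
  by (induction A rule: infinite_finite_induct) (simp_all add: qring_const_0 qring_const_add)

lemma qring_const_prod: "qring_const (prod g A) = (\<Prod>x\<in>A. qring_const (g x))"
  by (induction A rule: infinite_finite_induct) (simp_all add: qring_const_1 qring_const_mult)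

text \<open>Well defined because the constant coefficient vanishes on \<open>q_ideal\<close>. This
  is the ring homomorphism that sends every \<open>qvar i\<close> to 0, a left inverse of
  \<open>qring_const\<close>.\<close>

lift_definition qring_eval0 :: "'k :: comm_ring_1 qring \<Rightarrow> 'k" is "\<lambda>p. Poly_Mapping.lookup p 0"
  by (drule q_ideal_lookup_0) (simp add: lookup_minus)

lemma qring_eval0_0: "qring_eval0 0 = 0"
  by transfer simp

lemma qring_eval0_1: "qring_eval0 1 = 1"
  by transfer (simp add: lookup_one)

lemma qring_eval0_add: "qring_eval0 (a + b) = qring_eval0 a + qring_eval0 b"
  by transfer (simp add: lookup_add)

lemma qring_eval0_mult: "qring_eval0 (a * b) = qring_eval0 a * qring_eval0 b"
  by transfer (rule lookup_mult_0)

lemma qring_eval0_const: "qring_eval0 (qring_const c) = c"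
  by transfer simp

lemma qring_eval0_qvar: "qring_eval0 (qvar i) = 0"
  by transfer (simp add: poly_q_def lookup_single when_def poly_mapping_eq_iff fun_eq_iff)

lemma qring_eval0_power: "qring_eval0 (a ^ n) = qring_eval0 a ^ n"
  by (induction n) (simp_all add: qring_eval0_1 qring_eval0_mult)

lemma qring_eval0_sum: "qring_eval0 (sum g A) = (\<Sum>x\<in>A. qring_eval0 (g x))"
  by (induction A rule: infinite_finite_induct) (simp_all add: qring_eval0_0 qring_eval0_add)

lemma qring_eval0_prod: "qring_eval0 (prod g A) = (\<Prod>x\<in>A. qring_eval0 (g x))"
  by (induction A rule: infinite_finite_induct) (simp_all add: qring_eval0_1 qring_eval0_mult)

lemma qvar_relation: "(qvar i :: 'k :: comm_ring_1 qring) * (qvar i - 1)\<^sup>2 = 0"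
proof -
  have "(qvar i :: 'k qring) * ((qvar i - 1) * (qvar i - 1)) = 0"
    by transfer
      (simp add: q_ideal_def, rule ring_ideal.span_base, auto simp: power2_eq_square)
  then show ?thesis by (simp only: power2_eq_square)
qed

text \<open>
  Modulo \<open>q (q - 1)\<^sup>2\<close> a polynomial is determined by its value at 0 and its value and
  derivative at 1, and for \<open>q ^ c\<close> these are [c = 0], 1 and c.
\<close>

lemma qvar_power:
  "(qvar i :: 'k :: comm_ring_1 qring) ^ c =
     (1 - qvar i)\<^sup>2 * of_bool (c = 0) + (2 * qvar i - (qvar i)\<^sup>2) + ((qvar i)\<^sup>2 - qvar i) * of_nat c"
proof -
  define q where "q = (qvar i :: 'k qring)"
  have "q ^ 3 - (2 * q\<^sup>2 - q) = q * (q - 1)\<^sup>2"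
    by (simp add: power2_eq_square power3_eq_cube algebra_simps)
  then have rel: "q ^ 3 = 2 * q\<^sup>2 - q" by (simp add: q_def qvar_relation)
  \<comment> \<open>The induction starts at exponent 1, where the indicator vanishes. Exponent 0 is
    the identity (1 - q)^2 + (2q - q^2) = 1.\<close>
  have "q ^ Suc c = (2 * q - q\<^sup>2) + (q\<^sup>2 - q) * of_nat (Suc c)" for c
  proof (induction c)
    case (Suc c)
    have "q ^ Suc (Suc c) = q * ((2 * q - q\<^sup>2) + (q\<^sup>2 - q) * of_nat (Suc c))"
      using Suc by simp
    also have "\<dots> = 2 * q\<^sup>2 - q ^ 3 + (q ^ 3 - q\<^sup>2) * of_nat (Suc c)"
      by (simp add: power2_eq_square power3_eq_cube algebra_simps)
    also have "\<dots> = (2 * q - q\<^sup>2) + (q\<^sup>2 - q) * of_nat (Suc (Suc c))"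
      unfolding rel by (simp add: algebra_simps)
    finally show ?case .
  qed (simp add: algebra_simps)
  then show ?thesis
    unfolding q_def[symmetric] by (cases c) (simp_all add: power2_diff del: power_Suc of_nat_Suc)
qed


section \<open>Coefficients of the invariants\<close>

text \<open>The exponent vector of the monomial x_f.\<close>

definition content :: "sgraph \<Rightarrow> (nat \<Rightarrow> nat) \<Rightarrow> monomial" where
  "content G f = (\<Sum>v\<in>verts G. Poly_Mapping.single (f v) 1)"

definition colorings_of :: "sgraph \<Rightarrow> monomial \<Rightarrow> (nat \<Rightarrow> nat) set" where
  "colorings_of G m = {f \<in> colorings G. content G f = m}"

lemma finite_verts [simp]: "finite (verts G)"
  by (simp add: verts_def)

lemma finite_edges [simp]: "finite (edges G)"
  by (rule finite_subset[of _ "Pow (verts G)"]) (use edges_subset in auto)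

lemma lookup_content: "Poly_Mapping.lookup (content G f) i = card {v \<in> verts G. f v = i}"
  by (simp add: content_def lookup_sum lookup_single when_def sum.If_cases Int_def)

lemma mps_coeff_X_mult:
  "mps_coeff (mps_X i * a) (Poly_Mapping.single i 1 + m) = mps_coeff a m"
proof -
  have "mps_coeff (mps_X i * a) (Poly_Mapping.single i 1 + m) =
      (\<Sum>p\<in>{(Poly_Mapping.single i 1, m)}. mps_coeff (mps_X i) (fst p) * mps_coeff a (snd p))"
    unfolding times_mps_def mps_coeff_Abs
    by (intro sum.mono_neutral_right finite_add_decomp) (auto simp: mps_X_def)
  then show ?thesis by (simp add: mps_X_def)
qed

lemma mps_coeff_x_coloring:
  "mps_coeff (x_coloring G f :: 'a :: comm_ring_1 mps) m = of_bool (content G f = m)"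
proof (cases "content G f = m")
  case True
  have "mps_coeff (\<Prod>v\<in>A. mps_X (f v) :: 'a mps) (\<Sum>v\<in>A. Poly_Mapping.single (f v) 1) = 1"
    if "finite A" for A
    using that
  proof (induction A rule: finite_induct)
    case (insert v A)
    show ?case
      unfolding sum.insert[OF insert.hyps] prod.insert[OF insert.hyps] mps_coeff_X_mult
      by (rule insert.IH)
  qed (simp add: one_mps_def)
  from this[OF finite_verts] show ?thesis
    unfolding x_coloring_def True[symmetric] content_def by simp
next
  case False
  then show ?thesis
    using mps_coeff_x_coloring_eq_0[where m = m and G = G and f = f] by (auto simp: content_def)
qed

lemma finite_colorings_of: "finite (colorings_of G m)"
proof (rule finite_subset)
  \<comment> \<open>The constant weight 1 over the integers makes the coefficient the indicator of
    \<open>content G f = m\<close>, so the general finiteness result applies.\<close>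
  show "colorings_of G m \<subseteq> {f \<in> colorings G.
      mps_coeff (x_coloring G f * mps_const ((\<lambda>_. 1 :: int) f)) m \<noteq> 0}"
    by (auto simp: colorings_of_def mult.commute[of "x_coloring _ _"] mps_coeff_const_mult
        mps_coeff_x_coloring)
qed (rule finite_colorings_of_monomial)

lemma mps_coeff_chrom:
  "mps_coeff (chrom G :: 'a :: comm_ring_1 mps) m =
     (\<Sum>f\<in>colorings_of G m. of_bool (proper G f))"
proof -
  have "mps_coeff (chrom G :: 'a mps) m =
      (\<Sum>f | f \<in> colorings G \<and> proper G f \<and> content G f = m. 1)"
    unfolding chrom_def mps_Sum_def mps_coeff_Abs
    by (intro sum.cong) (auto simp: mps_coeff_x_coloring)
  also have "\<dots> = (\<Sum>f\<in>colorings_of G m. of_bool (proper G f))"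
    by (intro sum.mono_neutral_cong_left finite_colorings_of) (auto simp: colorings_of_def)
  finally show ?thesis .
qed

section \<open>Monochromatic edges inside a colour class\<close>

lemma mono_edges_subset_class:
  assumes "e \<in> edges G" "\<forall>u\<in>e. f u = i"
  shows "e \<subseteq> {v \<in> verts G. f v = i}" "card e = 2"
  using assms edges_subset[of e G] by auto

lemma mono_edges_small_class:
  assumes "card {v \<in> verts G. f v = i} \<le> 1"
  shows "mono_edges G f i = 0"
proof -
  have False if e: "e \<in> edges G" "\<forall>v\<in>e. f v = i" for e
    using card_mono[OF _ mono_edges_subset_class(1)[OF e]] mono_edges_subset_class(2)[OF e] assms
    by simp
  then have "{e \<in> edges G. \<forall>v\<in>e. f v = i} = {}" by blast
  then show ?thesis by (simp only: mono_edges_def card.empty)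
qed

lemma mono_edges_eq_0: "i \<notin> Poly_Mapping.keys (content G f) \<Longrightarrow> mono_edges G f i = 0"
  by (rule mono_edges_small_class) (simp add: in_keys_iff lookup_content[symmetric])

lemma mps_coeff_aug_chrom:
  "mps_coeff (aug_chrom G :: 'k :: comm_ring_1 qring mps) m =
     (\<Sum>f\<in>colorings_of G m. \<Prod>i\<in>Poly_Mapping.keys m. qvar i ^ mono_edges G f i)"
proof -
  let ?c = "\<lambda>f. (\<Prod>i. qvar i ^ mono_edges G f i) :: 'k qring"
  have coeff: "mps_coeff (x_coloring G f * mps_const (?c f)) m = ?c f * of_bool (content G f = m)"
    for f
    by (simp add: mult.commute[of "x_coloring _ _"] mps_coeff_const_mult mps_coeff_x_coloring)
  have "mps_coeff (aug_chrom G :: 'k qring mps) m = (\<Sum>f\<in>colorings_of G m. ?c f)"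
    unfolding aug_chrom_def mps_Sum_def mps_coeff_Abs coeff
    by (intro sum.mono_neutral_cong_left finite_colorings_of) (auto simp: colorings_of_def)
  also have "\<dots> = (\<Sum>f\<in>colorings_of G m. \<Prod>i\<in>Poly_Mapping.keys m. qvar i ^ mono_edges G f i)"
  proof (intro sum.cong refl Prod_any.expand_superset subsetI finite_keys)
    fix f i
    assume "f \<in> colorings_of G m" "i \<in> {i. (qvar i ^ mono_edges G f i :: 'k qring) \<noteq> 1}"
    then have "content G f = m" "mono_edges G f i \<noteq> 0"
      by (auto simp: colorings_of_def intro: Nat.gr0I)
    then show "i \<in> Poly_Mapping.keys m" using mono_edges_eq_0 by metis
  qed
  finally show ?thesis .
qed

lemma mps_coeff_sum: "mps_coeff (sum g A) m = (\<Sum>x\<in>A. mps_coeff (g x) m)"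
  by (induction A rule: infinite_finite_induct) (simp_all add: zero_mps_def plus_mps_def)

lemma proper_iff_mono_edges:
  "proper G f \<longleftrightarrow> (\<forall>i\<in>Poly_Mapping.keys (content G f). mono_edges G f i = 0)"
proof -
  have "proper G f \<longleftrightarrow> (\<forall>i. mono_edges G f i = 0)"
  proof
    assume proper: "proper G f"
    show "\<forall>i. mono_edges G f i = 0"
    proof
      fix i
      have "\<not> (\<forall>v\<in>e. f v = i)" if "e \<in> edges G" for e
      proof -
        have "card e = 2" using edges_subset[OF that] by simp
        then obtain u v where "e = {u, v}" by (auto simp: card_2_iff)
        moreover from this have "f u \<noteq> f v" using proper that by (simp add: proper_def)
        ultimately show ?thesis by auto
      qed
      then have "{e \<in> edges G. \<forall>v\<in>e. f v = i} = {}" by blast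
      then show "mono_edges G f i = 0" by (simp only: mono_edges_def card.empty)
    qed
  next
    assume zero: "\<forall>i. mono_edges G f i = 0"
    \<comment> \<open>Cardinality 0 gives emptiness because \<open>edges G\<close> is
      finite.\<close>
    have empty: "{e \<in> edges G. \<forall>v\<in>e. f v = i} = {}" for i
      using zero[rule_format, of i] by (simp add: mono_edges_def)
    show "proper G f"
      unfolding proper_def
    proof (intro allI impI notI)
      fix u v assume "{u, v} \<in> edges G" "f u = f v"
      then show False using empty[of "f v"] by auto
    qed
  qed
  then show ?thesis using mono_edges_eq_0[of _ G f] by blast
qed

lemma prod_of_bool:
  "finite A \<Longrightarrow> (\<Prod>x\<in>A. of_bool (P x)) = (of_bool (\<forall>x\<in>A. P x) :: 'a :: comm_semiring_1)"
  by (induction A rule: finite_induct) auto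

text \<open>Since \<open>0 ^ c\<close> is 1 for c = 0 and 0 otherwise, evaluation at q = 0 keeps
  exactly the proper colourings.\<close>

lemma mps_coeff_chrom_eq_eval0:
  "mps_coeff (chrom G :: 'k :: comm_ring_1 mps) m = qring_eval0 (mps_coeff (aug_chrom G) m)"
proof -
  have "(\<Prod>i\<in>Poly_Mapping.keys m. 0 ^ mono_edges G f i :: 'k) = of_bool (proper G f)"
    if "content G f = m" for f
    unfolding proper_iff_mono_edges that by (simp add: power_0_left prod_of_bool flip: of_bool_def)
  then show ?thesis
    by (auto simp: mps_coeff_chrom mps_coeff_aug_chrom qring_eval0_sum qring_eval0_prod
        qring_eval0_power qring_eval0_qvar colorings_of_def intro!: sum.cong)
qed

lemma mps_coeff_chrom_lin_eq_eval0:
  "mps_coeff (chrom_lin v :: 'k :: comm_ring_1 mps) m = qring_eval0 (mps_coeff (aug_chrom_lin v) m)"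
  by (simp add: chrom_lin_def aug_chrom_lin_def mps_coeff_sum mps_coeff_const_mult
      qring_eval0_sum qring_eval0_mult qring_eval0_const mps_coeff_chrom_eq_eval0)


section \<open>Recolouring one vertex with a fresh colour\<close>

lemma keys_single_add:
  "Poly_Mapping.keys (Poly_Mapping.single j 1 + r) = insert j (Poly_Mapping.keys r)"
  for r :: monomial
  by (auto simp: in_keys_iff lookup_add lookup_single when_def split: if_splits)

text \<open>The additive form avoids truncated subtraction of exponents.\<close>

lemma content_upd:
  assumes "v \<in> verts G"
  shows "content G (f(v := j)) + Poly_Mapping.single (f v) 1 = content G f + Poly_Mapping.single j 1"
proof -
  have "(\<Sum>w\<in>verts G - {v}. Poly_Mapping.single ((f(v := j)) w) (1 :: nat)) =
        (\<Sum>w\<in>verts G - {v}. Poly_Mapping.single (f w) 1)"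
    by (intro sum.cong) auto
  then show ?thesis
    using assms by (simp add: content_def sum.remove[of _ v] ac_simps)
qed

lemma colorings_upd: "f \<in> colorings G \<Longrightarrow> v \<in> verts G \<Longrightarrow> f(v := j) \<in> colorings G"
  by (auto simp: colorings_def PiE_iff extensional_def)

text \<open>As \<open>j\<close> is fresh, each colouring on the left has exactly one vertex
  \<open>v\<close> of colour \<open>j\<close>. Giving \<open>v\<close> the colour \<open>i\<close>
  and remembering \<open>v\<close> is a bijection onto pairs of a colouring on the right and a
  vertex of its class \<open>i\<close>.\<close>

lemma sum_colorings_recolor:
  fixes h :: "(nat \<Rightarrow> nat) \<Rightarrow> 'a :: comm_semiring_1"
  assumes j: "j \<notin> Poly_Mapping.keys r" "j \<noteq> i"
  shows "(\<Sum>f\<in>colorings_of G (Poly_Mapping.single j 1 + r). h f) =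
    (\<Sum>f\<in>colorings_of G (Poly_Mapping.single i 1 + r). \<Sum>v | v \<in> verts G \<and> f v = i. h (f(v := j)))"
    (is "sum h ?J = _")
proof -
  let ?I = "colorings_of G (Poly_Mapping.single i 1 + r)"
  have "card {v \<in> verts G. f v = j} = 1" if "f \<in> ?J" for f
    using that j by (simp add: colorings_of_def lookup_content[symmetric] lookup_add in_keys_iff)
  \<comment> \<open>The inner sum has one term; it only names the vertex to be recoloured.\<close>
  then have "sum h ?J = (\<Sum>f\<in>?J. \<Sum>v | v \<in> verts G \<and> f v = j. h f)"
    by (intro sum.cong) auto
  also have "\<dots> = (\<Sum>(f, v)\<in>(SIGMA f:?J. {v \<in> verts G. f v = j}). h f)"
    by (rule sum.Sigma) (auto intro: finite_colorings_of)
  also have "\<dots> = (\<Sum>(f, v)\<in>(SIGMA f:?I. {v \<in> verts G. f v = i}). h (f(v := j)))"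
  proof (rule sum.reindex_bij_witness[of _ "\<lambda>(f, v). (f(v := j), v)" "\<lambda>(f, v). (f(v := i), v)"])
    fix p assume "p \<in> (SIGMA f:?J. {v \<in> verts G. f v = j})"
    then obtain f v where p: "p = (f, v)" "f \<in> ?J" "v \<in> verts G" "f v = j" by auto
    have "content G (f(v := i)) + Poly_Mapping.single j 1 =
        (Poly_Mapping.single i 1 + r) + Poly_Mapping.single j 1"
      using content_upd[of v G f i] p by (simp add: colorings_of_def ac_simps)
    then show "(case p of (f, v) \<Rightarrow> (f(v := i), v)) \<in> (SIGMA f:?I. {v \<in> verts G. f v = i})"
      using p by (auto simp: colorings_of_def colorings_upd)
    show "(case case p of (f, v) \<Rightarrow> (f(v := i), v) of (f, v) \<Rightarrow> (f(v := j), v)) = p"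
      using p by auto
    show "(case case p of (f, v) \<Rightarrow> (f(v := i), v) of (f, v) \<Rightarrow> h (f(v := j))) =
        (case p of (f, v) \<Rightarrow> h f)"
      using p by auto
  next
    fix p assume "p \<in> (SIGMA f:?I. {v \<in> verts G. f v = i})"
    then obtain f v where p: "p = (f, v)" "f \<in> ?I" "v \<in> verts G" "f v = i" by auto
    have "content G (f(v := j)) + Poly_Mapping.single i 1 =
        (Poly_Mapping.single j 1 + r) + Poly_Mapping.single i 1"
      using content_upd[of v G f j] p by (simp add: colorings_of_def ac_simps)
    then show "(case p of (f, v) \<Rightarrow> (f(v := j), v)) \<in> (SIGMA f:?J. {v \<in> verts G. f v = j})"
      using p by (auto simp: colorings_of_def colorings_upd)
    show "(case case p of (f, v) \<Rightarrow> (f(v := j), v) of (f, v) \<Rightarrow> (f(v := i), v)) = p"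
      using p by auto
  qed
  also have "\<dots> = (\<Sum>f\<in>?I. \<Sum>v | v \<in> verts G \<and> f v = i. h (f(v := j)))"
    by (rule sum.Sigma[symmetric]) (auto intro: finite_colorings_of)
  finally show ?thesis .
qed

section \<open>Edges of a class after one vertex has left\<close>

lemma mono_edges_upd_other:
  assumes "l \<noteq> j" "l \<noteq> f v"
  shows "mono_edges G (f(v := j)) l = mono_edges G f l"
proof -
  have "{e \<in> edges G. \<forall>u\<in>e. (f(v := j)) u = l} = {e \<in> edges G. \<forall>u\<in>e. f u = l}"
    using assms by auto
  then show ?thesis by (simp only: mono_edges_def)
qed

lemma mono_edges_upd_same:
  assumes "f v \<noteq> j"
  shows "mono_edges G (f(v := j)) (f v) = card {e \<in> edges G. (\<forall>u\<in>e. f u = f v) \<and> v \<notin> e}"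
proof -
  have "{e \<in> edges G. \<forall>u\<in>e. (f(v := j)) u = f v} =
      {e \<in> edges G. (\<forall>u\<in>e. f u = f v) \<and> v \<notin> e}"
    using assms by auto
  then show ?thesis by (simp only: mono_edges_def)
qed

text \<open>An edge has two ends, so inside such a class it must be the whole class.\<close>

lemma mono_edges_pair_class:
  assumes "card {v \<in> verts G. f v = i} \<le> 2"
  shows "mono_edges G f i \<le> 1"
proof -
  have "e = {v \<in> verts G. f v = i}" if e: "e \<in> edges G" "\<forall>v\<in>e. f v = i" for e
    using mono_edges_subset_class[OF e] assms by (intro card_seteq) auto
  then have "{e \<in> edges G. \<forall>v\<in>e. f v = i} \<subseteq> {{v \<in> verts G. f v = i}}" by blast
  from card_mono[OF _ this] show ?thesis by (simp add: mono_edges_def)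
qed

text \<open>Double counting of pairs of an edge in the class and a class vertex off that edge. The
  truncated subtraction is harmless: an edge forces at least two vertices, and without edges both
  sides are 0.\<close>

lemma sum_mono_edges_upd:
  assumes "i \<noteq> j"
  shows "(\<Sum>v | v \<in> verts G \<and> f v = i. mono_edges G (f(v := j)) i) =
    (card {v \<in> verts G. f v = i} - 2) * mono_edges G f i"
proof -
  let ?W = "{v \<in> verts G. f v = i}" and ?E = "{e \<in> edges G. \<forall>v\<in>e. f v = i}"
  have "(\<Sum>v\<in>?W. mono_edges G (f(v := j)) i) = (\<Sum>v\<in>?W. card {e \<in> ?E. v \<notin> e})"
  proof (rule sum.cong)
    fix v assume "v \<in> ?W"
    then have "mono_edges G (f(v := j)) i = card {e \<in> edges G. (\<forall>u\<in>e. f u = i) \<and> v \<notin> e}"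
      using mono_edges_upd_same[of f v j G] assms by auto
    then show "mono_edges G (f(v := j)) i = card {e \<in> ?E. v \<notin> e}"
      by (simp add: conj_assoc)
  qed simp
  also have "\<dots> = (card ?W - 2) * card ?E"
  proof (rule sum_multicount)
    show "\<forall>e\<in>?E. card {v \<in> ?W. v \<notin> e} = card ?W - 2"
    proof
      fix e assume "e \<in> ?E"
      then have "e \<subseteq> ?W" "card e = 2"
        using mono_edges_subset_class[of e G f i] by auto
      moreover from \<open>e \<subseteq> ?W\<close> have "finite e" by (rule finite_subset) simp
      ultimately have "card (?W - e) = card ?W - 2" by (simp add: card_Diff_subset)
      moreover have "{v \<in> ?W. v \<notin> e} = ?W - e" by blast
      ultimately show "card {v \<in> ?W. v \<notin> e} = card ?W - 2" by simp
    qed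
  qed auto
  finally show ?thesis by (simp add: mono_edges_def)
qed


section \<open>Weighted counts of colourings\<close>

text \<open>The three functionals of an exponent c: value at 0, value at 1 and derivative at 1 of
  \<open>q ^ c\<close>.\<close>

datatype weight_kind = Stable | Free | Count

fun weight :: "weight_kind \<Rightarrow> nat \<Rightarrow> 'a :: comm_ring_1" where
  "weight Stable c = of_bool (c = 0)"
| "weight Free c = 1"
| "weight Count c = of_nat c"

text \<open>Orders the kinds by reduction: \<open>Count\<close> is rewritten by \<open>Free\<close>
  and \<open>Stable\<close>, and \<open>Free\<close> by \<open>Stable\<close>.\<close>

fun rank :: "weight_kind \<Rightarrow> nat" where
  "rank Stable = 0"
| "rank Free = 1"
| "rank Count = 2"

definition weighted_count ::
    "monomial \<Rightarrow> (nat \<Rightarrow> weight_kind) \<Rightarrow> sgraph \<Rightarrow> 'a :: comm_ring_1" where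
  "weighted_count m t G =
     (\<Sum>f\<in>colorings_of G m. \<Prod>i\<in>Poly_Mapping.keys m. weight (t i) (mono_edges G f i))"

lemma weighted_count_Stable:
  assumes "\<And>i. i \<in> Poly_Mapping.keys m \<Longrightarrow> t i = Stable"
  shows "weighted_count m t G = mps_coeff (chrom G :: 'a :: comm_ring_1 mps) m"
proof -
  have "(\<Prod>i\<in>Poly_Mapping.keys m. weight (t i) (mono_edges G f i) :: 'a) = of_bool (proper G f)"
    if "content G f = m" for f
  proof -
    have "(\<Prod>i\<in>Poly_Mapping.keys m. weight (t i) (mono_edges G f i) :: 'a) =
        (\<Prod>i\<in>Poly_Mapping.keys m. of_bool (mono_edges G f i = 0))"
      using assms by (intro prod.cong) auto
    also have "\<dots> = of_bool (proper G f)"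
      unfolding proper_iff_mono_edges that by (simp add: prod_of_bool)
    finally show ?thesis .
  qed
  then show ?thesis
    by (auto simp: weighted_count_def mps_coeff_chrom colorings_of_def intro!: sum.cong)
qed

lemma weighted_count_upd:
  assumes "i \<in> Poly_Mapping.keys m"
  shows "(weighted_count m (t(i := s)) G :: 'a :: comm_ring_1) =
    (\<Sum>f\<in>colorings_of G m. weight s (mono_edges G f i) *
      (\<Prod>l\<in>Poly_Mapping.keys m - {i}. weight (t l) (mono_edges G f l)))"
proof -
  have "(\<Prod>l\<in>Poly_Mapping.keys m - {i}. weight ((t(i := s)) l) (mono_edges G f l) :: 'a) =
      (\<Prod>l\<in>Poly_Mapping.keys m - {i}. weight (t l) (mono_edges G f l))" for f
    by (intro prod.cong) auto
  then show ?thesis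
    by (simp add: weighted_count_def prod.remove[OF finite_keys assms])
qed

lemma weighted_count_split:
  assumes "i \<in> Poly_Mapping.keys m"
  shows "weighted_count m t G =
    (\<Sum>f\<in>colorings_of G m. weight (t i) (mono_edges G f i) *
      (\<Prod>l\<in>Poly_Mapping.keys m - {i}. weight (t l) (mono_edges G f l)))"
  using weighted_count_upd[OF assms, of t "t i" G] by simp

text \<open>A one-vertex class has no edges, so it is automatically stable.\<close>

lemma weighted_count_Free_singleton:
  assumes "t i = Free" "Poly_Mapping.lookup m i = 1"
  shows "weighted_count m t G = weighted_count m (t(i := Stable)) G"
proof -
  have i: "i \<in> Poly_Mapping.keys m" using assms by (simp add: in_keys_iff)
  have "mono_edges G f i = 0" if "f \<in> colorings_of G m" for f
    using that assms
    by (intro mono_edges_small_class) (auto simp: colorings_of_def lookup_content[symmetric])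
  then show ?thesis
    unfolding weighted_count_upd[OF i] weighted_count_split[OF i] by (simp add: assms)
qed

text \<open>At most one edge fits into the class, and c = 1 - [c = 0] for c in {0, 1}.\<close>

lemma weighted_count_Count_pair:
  assumes "i \<in> Poly_Mapping.keys m" "t i = Count" "Poly_Mapping.lookup m i \<le> 2"
  shows "weighted_count m t G =
    weighted_count m (t(i := Free)) G - weighted_count m (t(i := Stable)) G"
proof -
  have "(of_nat (mono_edges G f i) :: 'a) = 1 - of_bool (mono_edges G f i = 0)"
    if "f \<in> colorings_of G m" for f
  proof -
    have "mono_edges G f i \<le> 1"
      using that assms
      by (intro mono_edges_pair_class) (auto simp: colorings_of_def lookup_content[symmetric])
    then have "mono_edges G f i = 0 \<or> mono_edges G f i = 1" by linarith
    then show ?thesis by auto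
  qed
  then show ?thesis
    unfolding weighted_count_upd[OF assms(1)] weighted_count_split[OF assms(1)]
    by (auto simp: assms sum_subtractf[symmetric] left_diff_distrib intro!: sum.cong)
qed

text \<open>Here \<open>k\<close> is the size of class \<open>i\<close> before a vertex moves to
  \<open>j\<close>. The new class is a single vertex, so its kind \<open>Stable\<close> contributes
  the factor 1. Having \<open>i\<close> in the support of \<open>r\<close> keeps colour
  \<open>i\<close> in use after the move.\<close>

lemma weighted_count_recolor:
  fixes r :: monomial and i j :: nat
  defines "k \<equiv> Suc (Poly_Mapping.lookup r i)"
  assumes i: "i \<in> Poly_Mapping.keys r" and j: "j \<notin> Poly_Mapping.keys r" and ti: "t i \<noteq> Stable"
  shows "weighted_count (Poly_Mapping.single j 1 + r) (t(j := Stable)) G =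
    of_nat (if t i = Free then k else k - 2) *
      (weighted_count (Poly_Mapping.single i 1 + r) t G :: 'a :: comm_ring_1)"
proof -
  let ?K = "Poly_Mapping.keys r" and ?I = "colorings_of G (Poly_Mapping.single i 1 + r)"
  let ?s = "if t i = Free then k else k - 2"
  have ij: "j \<noteq> i" using i j by auto
  have keys_j: "Poly_Mapping.keys (Poly_Mapping.single j 1 + r) = insert j ?K"
    by (rule keys_single_add)
  have keys_i: "Poly_Mapping.keys (Poly_Mapping.single i 1 + r) = ?K"
    using i by (simp only: keys_single_add insert_absorb)
  have class_i: "card {v \<in> verts G. f v = i} = k" if "f \<in> ?I" for f
    using that by (auto simp: colorings_of_def lookup_content[symmetric] lookup_add k_def)
  have class_j: "f v \<noteq> j" if "f \<in> ?I" "v \<in> verts G" for f v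
  proof -
    have "card {v \<in> verts G. f v = j} = 0"
      using that j ij
      by (auto simp: colorings_of_def lookup_content[symmetric] lookup_add in_keys_iff lookup_single when_def)
    then show ?thesis using that by auto
  qed
  have "weighted_count (Poly_Mapping.single j 1 + r) (t(j := Stable)) G =
    (\<Sum>f\<in>?I. \<Sum>v | v \<in> verts G \<and> f v = i.
      \<Prod>l\<in>insert j ?K. weight ((t(j := Stable)) l) (mono_edges G (f(v := j)) l) :: 'a)"
    unfolding weighted_count_def keys_j by (rule sum_colorings_recolor[OF j ij])
  \<comment> \<open>Only the factor at \<open>i\<close> still depends on the moved vertex; summing
    it over the class then yields \<open>?s\<close>.\<close>
  also have "\<dots> = (\<Sum>f\<in>?I. \<Sum>v | v \<in> verts G \<and> f v = i.
      weight (t i) (mono_edges G (f(v := j)) i) *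
      (\<Prod>l\<in>?K - {i}. weight (t l) (mono_edges G f l)))"
  proof (intro sum.cong refl)
    fix f v assume f: "f \<in> ?I" and v: "v \<in> {v. v \<in> verts G \<and> f v = i}"
    have "{w \<in> verts G. (f(v := j)) w = j} = {v}"
      using v class_j[OF f] by auto
    then have "mono_edges G (f(v := j)) j = 0"
      by (intro mono_edges_small_class) simp
    then have "(\<Prod>l\<in>insert j ?K. weight ((t(j := Stable)) l) (mono_edges G (f(v := j)) l) :: 'a) =
        (\<Prod>l\<in>?K. weight ((t(j := Stable)) l) (mono_edges G (f(v := j)) l))"
      using j by simp
    also have "\<dots> = (\<Prod>l\<in>?K. weight (t l) (mono_edges G (f(v := j)) l))"
      using j by (intro prod.cong) auto
    also have "\<dots> = weight (t i) (mono_edges G (f(v := j)) i) *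
        (\<Prod>l\<in>?K - {i}. weight (t l) (mono_edges G (f(v := j)) l))"
      using i by (simp add: prod.remove[of _ i])
    also have "(\<Prod>l\<in>?K - {i}. weight (t l) (mono_edges G (f(v := j)) l) :: 'a) =
        (\<Prod>l\<in>?K - {i}. weight (t l) (mono_edges G f l))"
      using v j
      by (intro prod.cong refl arg_cong[where f = "weight _"] mono_edges_upd_other) auto
    finally show "(\<Prod>l\<in>insert j ?K. weight ((t(j := Stable)) l) (mono_edges G (f(v := j)) l)) =
      weight (t i) (mono_edges G (f(v := j)) i) *
      (\<Prod>l\<in>?K - {i}. weight (t l) (mono_edges G f l) :: 'a)" .
  qed
  also have "\<dots> = (\<Sum>f\<in>?I. of_nat ?s * (weight (t i) (mono_edges G f i) *
      (\<Prod>l\<in>?K - {i}. weight (t l) (mono_edges G f l))))"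
  proof (intro sum.cong refl)
    fix f assume f: "f \<in> ?I"
    have "(\<Sum>v | v \<in> verts G \<and> f v = i. weight (t i) (mono_edges G (f(v := j)) i)) =
        of_nat ?s * (weight (t i) (mono_edges G f i) :: 'a)"
    proof (cases "t i")
      case Count
      then show ?thesis
        using sum_mono_edges_upd[OF ij[symmetric], of G f] class_i[OF f]
        by (simp add: of_nat_sum[symmetric] of_nat_mult[symmetric] del: of_nat_sum of_nat_mult)
    qed (use ti class_i[OF f] in auto)
    then show "(\<Sum>v | v \<in> verts G \<and> f v = i. weight (t i) (mono_edges G (f(v := j)) i) *
        (\<Prod>l\<in>?K - {i}. weight (t l) (mono_edges G f l))) =
      of_nat ?s * (weight (t i) (mono_edges G f i) *
        (\<Prod>l\<in>?K - {i}. weight (t l) (mono_edges G f l)) :: 'a)"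
      by (simp add: sum_distrib_right[symmetric] mult.assoc[symmetric])
  qed
  also have "\<dots> = of_nat ?s * weighted_count (Poly_Mapping.single i 1 + r) t G"
    by (simp only: sum_distrib_left
        weighted_count_split[of i "Poly_Mapping.single i 1 + r", unfolded keys_i, OF i])
  finally show ?thesis .
qed


section \<open>The kernels\<close>

text \<open>The induction measure. Weighting by class sizes makes it drop both when a kind is
  lowered and when a vertex leaves a class that is not \<open>Stable\<close>.\<close>

definition total_rank :: "monomial \<Rightarrow> (nat \<Rightarrow> weight_kind) \<Rightarrow> nat" where
  "total_rank m t = (\<Sum>i\<in>Poly_Mapping.keys m. Poly_Mapping.lookup m i * rank (t i))"

lemma total_rank_upd_less:
  assumes "i \<in> Poly_Mapping.keys m" "rank s < rank (t i)"
  shows "total_rank m (t(i := s)) < total_rank m t"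
  unfolding total_rank_def
proof (rule sum_strict_mono_ex1)
  show "\<exists>l\<in>Poly_Mapping.keys m.
      Poly_Mapping.lookup m l * rank ((t(i := s)) l) < Poly_Mapping.lookup m l * rank (t l)"
    using assms by (intro bexI[OF _ assms(1)]) (simp add: in_keys_iff)
qed (use assms in auto)

text \<open>The moved vertex contributed \<open>rank (t i) > 0\<close> in its old class and
  contributes 0 in the new one.\<close>

lemma total_rank_recolor_less:
  assumes i: "i \<in> Poly_Mapping.keys r" and j: "j \<notin> Poly_Mapping.keys r" and ti: "t i \<noteq> Stable"
  shows "total_rank (Poly_Mapping.single j 1 + r) (t(j := Stable)) <
    total_rank (Poly_Mapping.single i 1 + r) t"
proof -
  have keys_j: "Poly_Mapping.keys (Poly_Mapping.single j 1 + r) = insert j (Poly_Mapping.keys r)"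
    by (rule keys_single_add)
  have keys_i: "Poly_Mapping.keys (Poly_Mapping.single i 1 + r) = Poly_Mapping.keys r"
    using i by (simp only: keys_single_add insert_absorb)
  have "total_rank (Poly_Mapping.single j 1 + r) (t(j := Stable)) =
      (\<Sum>l\<in>Poly_Mapping.keys r. Poly_Mapping.lookup r l * rank (t l))"
    unfolding total_rank_def keys_j using j
    by (auto simp: lookup_add lookup_single when_def intro!: sum.cong)
  also have "\<dots> < (\<Sum>l\<in>Poly_Mapping.keys r.
      Poly_Mapping.lookup (Poly_Mapping.single i 1 + r) l * rank (t l))"
  proof (rule sum_strict_mono_ex1)
    show "\<exists>l\<in>Poly_Mapping.keys r. Poly_Mapping.lookup r l * rank (t l) <
        Poly_Mapping.lookup (Poly_Mapping.single i 1 + r) l * rank (t l)"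
      using ti by (intro bexI[OF _ i]) (cases "t i"; simp add: lookup_add)
  qed (auto simp: lookup_add)
  finally show ?thesis unfolding total_rank_def keys_i .
qed

text \<open>Induction on \<open>total_rank\<close>: each reduction is linear with coefficients that
  do not depend on the graph, and if all kinds are \<open>Stable\<close> the sum is a coefficient of
  \<open>chrom_lin v\<close>.\<close>

lemma weighted_count_chrom_kernel:
  fixes v :: "'k :: field_char_0 graph_space"
  assumes "chrom_lin v = 0"
  shows "(\<Sum>G\<in>Poly_Mapping.keys v. Poly_Mapping.lookup v G * weighted_count m t G) = 0"
proof (induction "total_rank m t" arbitrary: m t rule: less_induct)
  case less
  let ?L = "\<lambda>m t. \<Sum>G\<in>Poly_Mapping.keys v. Poly_Mapping.lookup v G * weighted_count m t G"
  show ?case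
  proof (cases "\<forall>i\<in>Poly_Mapping.keys m. t i = Stable")
    case True
    then have "?L m t = mps_coeff (chrom_lin v) m"
      by (simp add: weighted_count_Stable chrom_lin_def mps_coeff_sum mps_coeff_const_mult)
    then show ?thesis by (simp add: assms zero_mps_def)
  next
    case False
    then obtain i where i: "i \<in> Poly_Mapping.keys m" and ti: "t i \<noteq> Stable" by blast
    then have pos: "Poly_Mapping.lookup m i > 0" by (simp add: in_keys_iff)
    \<comment> \<open>The bounds 2 and 3 make the recolouring factor nonzero and leave colour
      \<open>i\<close> in use after one vertex is removed.\<close>
    consider (singleton) "t i = Free" "Poly_Mapping.lookup m i = 1"
      | (pair) "t i = Count" "Poly_Mapping.lookup m i \<le> 2"
      | (large) "Poly_Mapping.lookup m i \<ge> (if t i = Free then 2 else 3)"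
      using ti pos by (cases "t i") force+
    then show ?thesis
    proof cases
      case singleton
      then show ?thesis
        using less[OF total_rank_upd_less[OF i, of Stable t]]
        by (simp add: weighted_count_Free_singleton)
    next
      case pair
      then show ?thesis
        using less[OF total_rank_upd_less[OF i, of Stable t]]
          less[OF total_rank_upd_less[OF i, of Free t]]
        by (simp add: weighted_count_Count_pair[OF i] right_diff_distrib sum_subtractf)
    next
      case large
      define r where "r = m - Poly_Mapping.single i 1"
      have m: "m = Poly_Mapping.single i 1 + r"
        using pos by (intro poly_mapping_eqI)
          (auto simp: r_def lookup_add lookup_minus lookup_single when_def)
      have lookup_r: "Suc (Poly_Mapping.lookup r i) = Poly_Mapping.lookup m i"
        by (simp add: m lookup_add)
      then have ir: "i \<in> Poly_Mapping.keys r"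
        using large by (auto simp: in_keys_iff split: if_splits)
      obtain j where j: "j \<notin> Poly_Mapping.keys r"
        using ex_new_if_finite[OF infinite_UNIV_nat finite_keys] by blast
      define s where "s = (if t i = Free then Poly_Mapping.lookup m i else Poly_Mapping.lookup m i - 2)"
      have "s \<noteq> 0" using large by (auto simp: s_def split: if_splits)
      have "weighted_count (Poly_Mapping.single j 1 + r) (t(j := Stable)) G =
          of_nat s * (weighted_count m t G :: 'k)" for G
        by (simp only: weighted_count_recolor[OF ir j, of t, OF ti] lookup_r m[symmetric] s_def)
      then have "of_nat s * ?L m t = ?L (Poly_Mapping.single j 1 + r) (t(j := Stable))"
        by (simp only: sum_distrib_left mult.left_commute)
      also have "\<dots> = 0"
        by (rule less) (use total_rank_recolor_less[OF ir j, of t, OF ti] in \<open>simp only: m[symmetric]\<close>)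
      \<comment> \<open>Characteristic 0 allows division by \<open>of_nat s\<close>.\<close>
      finally show ?thesis using \<open>s \<noteq> 0\<close> by simp
    qed
  qed
qed

text \<open>The Hermite interpolation basis modulo \<open>q (q - 1)^2\<close>, dual to value at 0,
  value at 1 and derivative at 1.\<close>

fun qvar_weight_coeff :: "nat \<Rightarrow> weight_kind \<Rightarrow> 'k :: comm_ring_1 qring" where
  "qvar_weight_coeff i Stable = (1 - qvar i)\<^sup>2"
| "qvar_weight_coeff i Free = 2 * qvar i - (qvar i)\<^sup>2"
| "qvar_weight_coeff i Count = (qvar i)\<^sup>2 - qvar i"

lemma qvar_power_weights:
  "(qvar i :: 'k :: comm_ring_1 qring) ^ c =
     (\<Sum>s\<in>{Stable, Free, Count}. qvar_weight_coeff i s * qring_const (weight s c))"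
  by (subst qvar_power)
    (simp add: qring_const_0 qring_const_1 qring_const_of_nat of_bool_def algebra_simps)

text \<open>Each power is a sum of three terms; expanding the product over colours chooses a kind
  \<open>t i\<close> for each colour. The factors \<open>?c t\<close> do not depend on
  \<open>G\<close>, so the formula extends linearly to graph combinations.\<close>

lemma mps_coeff_aug_chrom_weighted_count:
  "mps_coeff (aug_chrom G :: 'k :: comm_ring_1 qring mps) m =
     (\<Sum>t\<in>Poly_Mapping.keys m \<rightarrow>\<^sub>E {Stable, Free, Count}.
       (\<Prod>i\<in>Poly_Mapping.keys m. qvar_weight_coeff i (t i)) * qring_const (weighted_count m t G))"
  (is "_ = (\<Sum>t\<in>?T. ?c t * _)")
proof -
  have "mps_coeff (aug_chrom G :: 'k qring mps) m =
      (\<Sum>f\<in>colorings_of G m. \<Sum>t\<in>?T. \<Prod>i\<in>Poly_Mapping.keys m.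
        qvar_weight_coeff i (t i) * qring_const (weight (t i) (mono_edges G f i)))"
    unfolding mps_coeff_aug_chrom qvar_power_weights
    by (intro sum.cong refl prod_sum_PiE) auto
  also have "\<dots> = (\<Sum>t\<in>?T. \<Sum>f\<in>colorings_of G m. \<Prod>i\<in>Poly_Mapping.keys m.
        qvar_weight_coeff i (t i) * qring_const (weight (t i) (mono_edges G f i)))"
    by (rule sum.swap)
  also have "\<dots> = (\<Sum>t\<in>?T. ?c t * qring_const (weighted_count m t G))"
    by (simp add: weighted_count_def qring_const_sum qring_const_prod prod.distrib sum_distrib_left)
  finally show ?thesis .
qed

lemma chrom_kernel_subset_aug_chrom_kernel:
  fixes v :: "'k :: field_char_0 graph_space"
  assumes "chrom_lin v = 0"
  shows "aug_chrom_lin v = 0"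
proof (rule mps_eqI)
  fix m :: monomial
  let ?T = "Poly_Mapping.keys m \<rightarrow>\<^sub>E {Stable, Free, Count}"
  let ?c = "\<lambda>t. \<Prod>i\<in>Poly_Mapping.keys m. qvar_weight_coeff i (t i) :: 'k qring"
  have "mps_coeff (aug_chrom_lin v) m = (\<Sum>G\<in>Poly_Mapping.keys v. \<Sum>t\<in>?T.
      ?c t * qring_const (Poly_Mapping.lookup v G * weighted_count m t G))"
    unfolding aug_chrom_lin_def mps_coeff_sum mps_coeff_const_mult qring_const_mult
      mps_coeff_aug_chrom_weighted_count sum_distrib_left
    by (intro sum.cong refl mult.left_commute)
  also have "\<dots> = (\<Sum>t\<in>?T. \<Sum>G\<in>Poly_Mapping.keys v.
      ?c t * qring_const (Poly_Mapping.lookup v G * weighted_count m t G))"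
    by (rule sum.swap)
  also have "\<dots> = (\<Sum>t\<in>?T. ?c t * qring_const
      (\<Sum>G\<in>Poly_Mapping.keys v. Poly_Mapping.lookup v G * weighted_count m t G))"
    by (simp add: qring_const_sum sum_distrib_left)
  finally show "mps_coeff (aug_chrom_lin v) m = mps_coeff 0 m"
    by (simp add: weighted_count_chrom_kernel[OF assms] qring_const_0 zero_mps_def)
qed

lemma aug_chrom_kernel_subset_chrom_kernel:
  assumes "aug_chrom_lin v = 0"
  shows "chrom_lin v = 0"
  by (rule mps_eqI) (simp add: mps_coeff_chrom_lin_eq_eval0 assms zero_mps_def qring_eval0_0)

text \<open>Reduces equality of invariants of two graphs to kernel membership. Distinctness makes
  the support exactly the two graphs, with coefficients 1 and -1.\<close>

lemma lin_single_diff: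
  fixes G1 G2 :: sgraph
  assumes "G1 \<noteq> G2"
  defines "v \<equiv> Poly_Mapping.single G1 (1 :: 'k :: comm_ring_1) - Poly_Mapping.single G2 1"
  shows "chrom_lin v = chrom G1 - chrom G2" "aug_chrom_lin v = aug_chrom G1 - aug_chrom G2"
proof -
  have "Poly_Mapping.keys v = {G1, G2}"
    using assms by (auto simp: v_def in_keys_iff lookup_minus lookup_single when_def split: if_splits)
  moreover have "Poly_Mapping.lookup v G1 = 1" "Poly_Mapping.lookup v G2 = - 1"
    using assms by (auto simp: v_def lookup_minus lookup_single)
  moreover have "qring_const (- 1) = (- 1 :: 'k qring)"
    using qring_const_add[of 1 "- 1 :: 'k"]
    by (simp add: qring_const_0 qring_const_1 eq_neg_iff_add_eq_0 add.commute)
  ultimately show "chrom_lin v = chrom G1 - chrom G2" "aug_chrom_lin v = aug_chrom G1 - aug_chrom G2"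
    using assms(1)
    by - (rule mps_eqI, simp add: chrom_lin_def aug_chrom_lin_def qring_const_1
        mps_coeff_const_mult plus_mps_def minus_mps_def zero_mps_def)+
qed

theorem proposition18:
  shows "{v :: 'k :: field_char_0 graph_space. aug_chrom_lin v = 0} = {v. chrom_lin v = 0} \<and>
    (\<forall>G1 G2. (chrom G1 :: 'k mps) = chrom G2 \<longleftrightarrow> (aug_chrom G1 :: 'k qring mps) = aug_chrom G2)"
proof (intro conjI allI)
  have ker: "aug_chrom_lin v = 0 \<longleftrightarrow> chrom_lin v = 0" for v :: "'k graph_space"
    using chrom_kernel_subset_aug_chrom_kernel aug_chrom_kernel_subset_chrom_kernel by blast
  then show "{v :: 'k graph_space. aug_chrom_lin v = 0} = {v. chrom_lin v = 0}" by simp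
  fix G1 G2
  show "(chrom G1 :: 'k mps) = chrom G2 \<longleftrightarrow> (aug_chrom G1 :: 'k qring mps) = aug_chrom G2"
  proof (cases "G1 = G2")
    case False
    then show ?thesis
      using ker[of "Poly_Mapping.single G1 1 - Poly_Mapping.single G2 1"]
      by (simp add: lin_single_diff)
  qed simp
qed

end
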